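(* Let $n\ge 1$ be an integer, let $a_1,\dots,a_n\in\mathbb{C}$ with $|a_j|>1$ for all $j$, and let $W(z)=\prod_{j=1}^n(z-a_j)$ and $B(z)=\prod_{j=1}^n\frac{1-\overline{a_j}z}{z-a_j}$. Let $k\ge 1$ be real and suppose $R\in\mathcal{R}_n(a_1,\dots,a_n)$ has all its zeros in $\{z\in\mathbb{C}:|z|\ge k\}$; that is, $R(z)=\frac{P(z)}{W(z)}$ with $P(z)=\alpha_m\prod_{j=1}^m(z-b_j)$, $\alpha_m\ne 0$, $m\le n$, and $|b_j|\ge k\ge 1$ for $j=1,\dots,m$. Then for every $z\in\mathbb{C}$ with $|z|=1$, $$|R'(z)|\le \frac12\left[|B'(z)|-\frac{n(k-1)|R(z)|^2}{(k+1)\{M(R,1)\}^2}-\frac{2|R(z)|^2}{\{M(R,1)\}^2}\left\{\frac{n}{k+1}-\sum_{j=1}^m\frac{1}{1+|b_j|}\right\}\right]M(R,1).$$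
   Context: $\mathcal{R}_n(a_1,\dots,a_n)=\{P(z)/W(z): P \text{ a complex polynomial of degree at most } n\}$, where $W(z)=\prod_{j=1}^n(z-a_j)$; the $a_j$ need not be distinct. For a function $f$ defined on the unit circle, $M(f,1)=\sup_{|z|=1}|f(z)|$. *)

theory Defs
  imports "HOL-Complex_Analysis.Complex_Analysis" "HOL-Computational_Algebra.Polynomial"
begin

text \<open>The poles \<open>a 1, \<dots>, a n\<close> are given by a function on indices, so repetitions are allowed; values
  of \<open>a\<close> outside \<open>{1..n}\<close> are irrelevant.\<close>

definition W :: "nat \<Rightarrow> (nat \<Rightarrow> complex) \<Rightarrow> complex \<Rightarrow> complex" where
  "W n a z = (\<Prod>j=1..n. (z - a j))"

definition blaschke :: "nat \<Rightarrow> (nat \<Rightarrow> complex) \<Rightarrow> complex \<Rightarrow> complex" where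
  "blaschke n a z = (\<Prod>j=1..n. (1 - cnj (a j) * z) / (z - a j))"

text \<open>Elements are total functions taking the value 0 at the points \<open>a j\<close> (division by zero).
  When all \<open>a j\<close> lie outside the closed unit disc, this affects neither values nor
  derivatives on the unit circle.\<close>

definition rational_space :: "nat \<Rightarrow> (nat \<Rightarrow> complex) \<Rightarrow> (complex \<Rightarrow> complex) set" where
  "rational_space n a = {\<lambda>z. poly P z / W n a z | P. degree P \<le> n}"

definition sup_unit_circle :: "(complex \<Rightarrow> complex) \<Rightarrow> real" where
  "sup_unit_circle f = (SUP z\<in>sphere 0 1. norm (f z))"

end

theory Submission
  imports Defs "HOL-Computational_Algebra.Fundamental_Theorem_Algebra"
begin

text \<open>For \<open>|z| = 1\<close> put \<open>\<beta> = |B'(z)|\<close>. On the circle \<open>z B'/B = \<beta>\<close> and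
  \<open>Re (\<Sum> z / (z - a\<^sub>j)) = (n - \<beta>) / 2\<close>, so for \<open>S = Q / W\<close> with \<open>Q\<close> of degree at most \<open>n\<close> and
  zero-free in the closed disc, \<open>Re (z S'/S) \<le> \<beta> / 2\<close>, that is \<open>|S'| \<le> |\<beta> S - z S'|\<close>.
  By the maximum principle this applies to \<open>S = R - \<mu>\<close> for every \<open>|\<mu>| > M\<close>; a suitable choice
  of \<open>\<mu>\<close> gives \<open>|R'| + |\<beta> R - z R'| \<le> \<beta> M\<close>. Here \<open>|\<beta> R - z R'|\<close> is the modulus of the derivative
  of the conjugate transpose \<open>R\<^sup>* = B \<cdot> cnj (R (1 / cnj z))\<close>. The zeros of \<open>R\<close> give
  \<open>Re (z R'/R) \<le> (\<beta> - c) / 2\<close> with \<open>c = n - 2 \<Sum> 1 / (1 + |b\<^sub>j|)\<close>, hence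
  \<open>|R'|\<^sup>2 + \<beta> c |R|\<^sup>2 \<le> |\<beta> R - z R'|\<^sup>2 \<le> (\<beta> M - |R'|)\<^sup>2\<close>, which rearranges to the claim.\<close>

section \<open>Contribution of a single zero or pole at a point of the unit circle\<close>

text \<open>Expand \<open>|b|^2 = |z - (z - b)|^2\<close> with \<open>|z| = 1\<close>. The exact
  form serves the poles, where the subtracted quotients sum to \<open>\<beta>\<close>; for zeros the
  bound below suffices.\<close>

lemma Re_circle_divide_diff:
  fixes z b :: complex
  assumes "norm z = 1" "z \<noteq> b"
  shows "2 * Re (z / (z - b)) = 1 - ((norm b)\<^sup>2 - 1) / (norm (z - b))\<^sup>2"
proof -
  have z: "(Re z)\<^sup>2 + (Im z)\<^sup>2 = 1"
    using assms(1) cmod_power2[of z] by simp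
  have pos: "(norm (z - b))\<^sup>2 > 0"
    using assms(2) by simp
  have "Re (z / (z - b)) = (Re z * (Re z - Re b) + Im z * (Im z - Im b)) / (norm (z - b))\<^sup>2"
    by (simp add: Re_divide cmod_power2)
  moreover have "2 * (Re z * (Re z - Re b) + Im z * (Im z - Im b))
      = (norm (z - b))\<^sup>2 - ((norm b)\<^sup>2 - 1)"
    using z unfolding cmod_power2 by (simp add: power2_eq_square algebra_simps)
  ultimately show ?thesis
    using pos by (simp add: diff_divide_distrib)
qed

text \<open>For \<open>|b| \<ge> 1\<close> the quotient subtracted in the identity above is
  nonnegative and least when \<open>|z - b|\<close> takes its largest possible value
  \<open>1 + |b|\<close>.\<close>

lemma Re_circle_divide_diff_le:
  fixes z b :: complex
  assumes "norm z = 1" "z \<noteq> b" "norm b \<ge> 1"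
  shows "Re (z / (z - b)) \<le> 1 / (1 + norm b)"
proof -
  have "norm (z - b) \<le> 1 + norm b"
    using norm_triangle_ineq4[of z b] assms(1) by simp
  then have "(norm (z - b))\<^sup>2 \<le> (1 + norm b)\<^sup>2"
    by (simp add: power_mono)
  moreover have "0 < (norm (z - b))\<^sup>2"
    using assms(2) by simp
  ultimately have "((norm b)\<^sup>2 - 1) / (1 + norm b)\<^sup>2 \<le> ((norm b)\<^sup>2 - 1) / (norm (z - b))\<^sup>2"
    using assms(3) by (intro divide_left_mono mult_pos_pos) (auto simp: abs_square_le_1)
  moreover have "1 - ((norm b)\<^sup>2 - 1) / (1 + norm b)\<^sup>2 = 2 * (1 / (1 + norm b))"
  proof -
    have pos: "1 + norm b \<noteq> 0"
      using assms(3) by linarith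
    have "(norm b)\<^sup>2 - 1 = (norm b - 1) * (1 + norm b)"
      by (simp add: power2_eq_square algebra_simps)
    then have "((norm b)\<^sup>2 - 1) / (1 + norm b)\<^sup>2 = (norm b - 1) / (1 + norm b)"
      using pos by (simp add: power2_eq_square)
    then show ?thesis
      using pos by (simp add: field_simps)
  qed
  ultimately show ?thesis
    using Re_circle_divide_diff[OF assms(1,2)] by linarith
qed

section \<open>Logarithmic derivatives of products, Blaschke products and zero-free
  polynomials\<close>

lemma has_field_derivative_prod_log:
  fixes f :: "'i \<Rightarrow> 'a::real_normed_field \<Rightarrow> 'a"
  assumes "finite A" "\<And>i. i \<in> A \<Longrightarrow> (f i has_field_derivative f' i) (at z)"
    and "\<And>i. i \<in> A \<Longrightarrow> f i z \<noteq> 0"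
  shows "((\<lambda>w. \<Prod>i\<in>A. f i w) has_field_derivative (\<Prod>i\<in>A. f i z) * (\<Sum>i\<in>A. f' i / f i z)) (at z)"
  using assms
proof (induction A rule: finite_induct)
  case (insert x A)
  have "((\<lambda>w. f x w * (\<Prod>i\<in>A. f i w)) has_field_derivative
      f x z * ((\<Prod>i\<in>A. f i z) * (\<Sum>i\<in>A. f' i / f i z)) + f' x * (\<Prod>i\<in>A. f i z)) (at z)"
    using insert by (intro derivative_eq_intros) auto
  moreover have "f x z * ((\<Prod>i\<in>A. f i z) * (\<Sum>i\<in>A. f' i / f i z)) + f' x * (\<Prod>i\<in>A. f i z)
      = (\<Prod>i\<in>insert x A. f i z) * (\<Sum>i\<in>insert x A. f' i / f i z)"
    using insert by (simp add: field_simps)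
  ultimately show ?case
    using insert by simp
qed simp

text \<open>Each factor has modulus 1 at \<open>z\<close>, and \<open>z\<close> times its
  logarithmic derivative is a positive real. Hence nothing cancels in the sum, and taking norms
  keeps it exact.\<close>

lemma norm_deriv_blaschke:
  assumes "\<And>j. j \<in> {1..n} \<Longrightarrow> norm (a j) > 1" "norm z = 1"
  shows "norm (deriv (blaschke n a) z) = (\<Sum>j=1..n. ((norm (a j))\<^sup>2 - 1) / (norm (z - a j))\<^sup>2)"
proof -
  let ?g = "\<lambda>j w. (1 - cnj (a j) * w) / (w - a j)"
  let ?c = "\<lambda>j. ((norm (a j))\<^sup>2 - 1) / (norm (z - a j))\<^sup>2"
  have zz: "z * cnj z = 1"
    using assms(2) complex_norm_square[of z] by simp
  have ne: "z \<noteq> a j" if "j \<in> {1..n}" for j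
    using assms(1)[OF that] assms(2) by auto
  \<comment> \<open>Replacing 1 by \<open>z * cnj z\<close> exhibits the numerator as a unimodular
    multiple of the conjugate denominator.\<close>
  have num: "1 - cnj (a j) * z = z * cnj (z - a j)" for j
    using zz by (simp add: algebra_simps)
  have z0: "z \<noteq> 0"
    using assms(2) by auto
  have g: "norm (?g j z) = 1" if "j \<in> {1..n}" for j
    using ne[OF that] assms(2) unfolding num norm_divide norm_mult complex_mod_cnj by simp
  let ?d = "\<lambda>j. (- cnj (a j) * (z - a j) - (1 - cnj (a j) * z)) / ((z - a j) * (z - a j))"
  have deriv: "(?g j has_field_derivative ?d j) (at z)" if "j \<in> {1..n}" for j
    using ne[OF that] by (auto intro!: derivative_eq_intros)
  have log: "?d j / ?g j z = of_real (?c j) / z" if "j \<in> {1..n}" for j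
  proof -
    have "- cnj (a j) * (z - a j) - (1 - cnj (a j) * z) = of_real ((norm (a j))\<^sup>2 - 1)"
      using complex_norm_square[of "a j"] by (simp add: algebra_simps)
    moreover have "of_real ((norm (z - a j))\<^sup>2) = (z - a j) * cnj (z - a j)"
      using complex_norm_square[of "z - a j"] by simp
    moreover have "z - a j \<noteq> 0" "cnj (z - a j) \<noteq> 0"
      using ne[OF that] by (simp_all del: complex_cnj_diff)
    ultimately show ?thesis
      unfolding num using z0 by (simp add: divide_simps del: complex_cnj_diff)
  qed
  have "(blaschke n a has_field_derivative (\<Prod>j=1..n. ?g j z) * (\<Sum>j=1..n. ?d j / ?g j z)) (at z)"
    unfolding blaschke_def[abs_def]
    using g by (intro has_field_derivative_prod_log deriv) fastforce+
  then have "deriv (blaschke n a) z = (\<Prod>j=1..n. ?g j z) * (\<Sum>j=1..n. ?d j / ?g j z)"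
    by (rule DERIV_imp_deriv)
  moreover have "(\<Sum>j=1..n. ?d j / ?g j z) = of_real (\<Sum>j=1..n. ?c j) / z"
    unfolding of_real_sum sum_divide_distrib by (intro sum.cong refl log)
  moreover have "norm (\<Prod>j=1..n. ?g j z) = 1"
    using g by (simp add: prod_norm[symmetric])
  moreover have "0 \<le> (\<Sum>j=1..n. ?c j)"
    using assms(1) by (intro sum_nonneg divide_nonneg_nonneg) (auto simp: less_imp_le)
  ultimately show ?thesis
    using assms(2) by (simp only: norm_mult norm_divide norm_of_real)
qed

text \<open>Split off one root at a time: a root outside the closed disc contributes less than
  \<open>1 / 2\<close> to the real part.\<close>

lemma Re_log_pderiv_le_degree:
  fixes Q :: "complex poly"
  assumes "\<And>w. norm w \<le> 1 \<Longrightarrow> poly Q w \<noteq> 0" "norm z = 1"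
  shows "2 * Re (z * poly (pderiv Q) z / poly Q z) \<le> degree Q"
  using assms(1)
proof (induction "degree Q" arbitrary: Q)
  case 0
  then have "pderiv Q = 0"
    by (simp add: pderiv_eq_0_iff)
  then show ?case by simp
next
  case (Suc d)
  then obtain b where "poly Q b = 0"
    using fundamental_theorem_of_algebra[of Q] constant_degree[of Q] by auto
  then obtain S where Q: "Q = [:- b, 1:] * S"
    by (auto simp: poly_eq_0_iff_dvd)
  have S: "poly S w \<noteq> 0" if "norm w \<le> 1" for w
    using Suc(3)[OF that] by (auto simp: Q)
  then have "S \<noteq> 0"
    by (metis norm_zero poly_0 zero_le_one)
  then have deg: "degree Q = Suc (degree S)"
    unfolding Q by (subst degree_mult_eq) auto
  have IH: "2 * Re (z * poly (pderiv S) z / poly S z) \<le> degree S"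
    using Suc(1)[of S] Suc(2) deg S by auto
  have b: "norm b > 1"
    using Suc(3)[of b] \<open>poly Q b = 0\<close> by force
  then have zb: "z \<noteq> b"
    using assms(2) by auto
  have "z * poly (pderiv Q) z / poly Q z = z / (z - b) + z * poly (pderiv S) z / poly S z"
    unfolding Q pderiv_mult using zb S[of z] assms(2)
    by (simp add: pderiv_pCons field_simps)
  moreover have "2 * Re (z / (z - b)) \<le> 1"
  proof -
    have "1 / (1 + norm b) \<le> 1 / 2"
      using b by simp
    then show ?thesis
      using Re_circle_divide_diff_le[OF assms(2) zb] b by linarith
  qed
  ultimately show ?case
    using IH deg by simp
qed

section \<open>Two inequalities for complex numbers\<close>

text \<open>With \<open>q = w / S\<close>, expand
  \<open>|\<beta> - q|^2 = \<beta>^2 - 2 \<beta> Re q + |q|^2\<close>. It is applied with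
  \<open>c = 0\<close> to the shifted function and with the \<open>c\<close> coming from the zeros
  to \<open>R\<close>.\<close>

lemma norm_add_le_norm_diff:
  fixes S w :: complex and \<beta> c :: real
  assumes "S \<noteq> 0 \<Longrightarrow> 2 * Re (w / S) \<le> \<beta> - c" "\<beta> \<ge> 0"
  shows "(norm w)\<^sup>2 + \<beta> * c * (norm S)\<^sup>2 \<le> (norm (of_real \<beta> * S - w))\<^sup>2"
proof (cases "S = 0")
  case False
  define q where "q = w / S"
  have w: "w = q * S"
    using False by (simp add: q_def)
  have "(norm (of_real \<beta> - q))\<^sup>2 = \<beta>\<^sup>2 + (norm q)\<^sup>2 - \<beta> * (2 * Re q)"
    unfolding cmod_power2 by (simp add: power2_eq_square algebra_simps)
  moreover have "\<beta> * (2 * Re q) \<le> \<beta> * (\<beta> - c)"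
    using assms False by (intro mult_left_mono) (auto simp: q_def)
  ultimately have "(norm q)\<^sup>2 + \<beta> * c \<le> (norm (of_real \<beta> - q))\<^sup>2"
    by (simp add: power2_eq_square algebra_simps)
  then have "((norm q)\<^sup>2 + \<beta> * c) * (norm S)\<^sup>2 \<le> (norm (of_real \<beta> - q))\<^sup>2 * (norm S)\<^sup>2"
    by (intro mult_right_mono) auto
  moreover have "of_real \<beta> * S - w = (of_real \<beta> - q) * S"
    by (simp add: w algebra_simps)
  ultimately show ?thesis
    by (simp add: w norm_mult power_mult_distrib distrib_right mult.assoc)
qed simp

text \<open>The exterior of the disc of radius \<open>r\<close> has distance \<open>r - |u|\<close>
  from \<open>u\<close> if \<open>|u| \<le> r\<close>, and distance 0 otherwise;
  \<open>v > 0\<close> excludes the second case.\<close>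

lemma norm_add_le_of_outer_distance:
  fixes u :: complex
  assumes "\<And>\<nu>. norm \<nu> > r \<Longrightarrow> v \<le> norm (u - \<nu>)" "r \<ge> 0" "v > 0"
  shows "norm u + v \<le> r"
proof (rule ccontr)
  assume "\<not> norm u + v \<le> r"
  with assms(3) have "max r (norm u) < norm u + v"
    by simp
  \<comment> \<open>The violating point has modulus \<open>t\<close> and lies on the ray through
    \<open>u\<close>, so its distance from \<open>u\<close> is \<open>t - |u| < v\<close>.\<close>
  then obtain t where t: "max r (norm u) < t" "t < norm u + v"
    using dense by blast
  define e where "e = (if u = 0 then 1 else sgn u)"
  have e: "norm e = 1" "u = of_real (norm u) * e"
    by (simp_all add: e_def norm_sgn) (simp add: sgn_eq)
  have "u - of_real t * e = of_real (norm u - t) * e"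
    by (subst e(2)) (simp add: algebra_simps)
  then have "norm (u - of_real t * e) = t - norm u"
    using t e(1) by (simp add: norm_mult del: of_real_diff)
  moreover have "norm (of_real t * e) > r"
    using t assms(2) e(1) by (simp add: norm_mult)
  ultimately show False
    using assms(1)[of "of_real t * e"] t by simp
qed

section \<open>Polynomials in factored form and the denominator \<open>W\<close>\<close>

lemma prod_linear_factors_eq_0_iff:
  fixes b :: "'i \<Rightarrow> 'a::idom"
  assumes "finite A"
  shows "poly (\<Prod>j\<in>A. [:- b j, 1:]) z = 0 \<longleftrightarrow> z \<in> b ` A"
  using assms by (auto simp: poly_prod)

lemma log_pderiv_prod_linear_factors:
  fixes b :: "'i \<Rightarrow> 'a::real_normed_field"
  assumes "finite A" "z \<notin> b ` A"
  shows "poly (pderiv (\<Prod>j\<in>A. [:- b j, 1:])) z / poly (\<Prod>j\<in>A. [:- b j, 1:]) z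
    = (\<Sum>j\<in>A. 1 / (z - b j))"
proof -
  have "((\<lambda>w. \<Prod>j\<in>A. w - b j) has_field_derivative
      (\<Prod>j\<in>A. z - b j) * (\<Sum>j\<in>A. 1 / (z - b j))) (at z)"
    using assms by (intro has_field_derivative_prod_log) (auto intro!: derivative_eq_intros)
  moreover have "poly (\<Prod>j\<in>A. [:- b j, 1:]) = (\<lambda>w. \<Prod>j\<in>A. w - b j)"
    by (auto simp: poly_prod)
  ultimately have "poly (pderiv (\<Prod>j\<in>A. [:- b j, 1:])) z
      = poly (\<Prod>j\<in>A. [:- b j, 1:]) z * (\<Sum>j\<in>A. 1 / (z - b j))"
    using DERIV_unique poly_DERIV by metis
  then show ?thesis
    using assms by (simp add: prod_linear_factors_eq_0_iff)
qed

text \<open>The denominator \<open>W\<close> as a formal polynomial, so that \<open>degree\<close>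
  and \<open>pderiv\<close> apply and constants can be absorbed into numerators.\<close>

definition pole_poly :: "nat \<Rightarrow> (nat \<Rightarrow> complex) \<Rightarrow> complex poly" where
  "pole_poly n a = (\<Prod>j=1..n. [:- a j, 1:])"

lemma poly_pole_poly: "poly (pole_poly n a) w = W n a w"
  by (simp add: pole_poly_def W_def poly_prod)

lemma degree_pole_poly: "degree (pole_poly n a) = n"
  unfolding pole_poly_def by (subst degree_prod_eq_sum_degree) auto

lemma W_nonzero:
  assumes "\<And>j. j \<in> {1..n} \<Longrightarrow> norm (a j) > 1" "norm w \<le> 1"
  shows "W n a w \<noteq> 0"
  using assms unfolding W_def by (force simp: prod_zero_iff)

section \<open>Logarithmic derivatives of rational functions with poles outside the disc\<close>

locale outer_poles =
  fixes n :: nat and a :: "nat \<Rightarrow> complex" and z :: complex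
  assumes norm_pole: "\<And>j. j \<in> {1..n} \<Longrightarrow> norm (a j) > 1"
    and norm_z: "norm z = 1"
begin

definition \<beta> :: real where "\<beta> = norm (deriv (blaschke n a) z)"

lemma \<beta>_eq: "\<beta> = (\<Sum>j=1..n. ((norm (a j))\<^sup>2 - 1) / (norm (z - a j))\<^sup>2)"
  unfolding \<beta>_def using norm_pole norm_z by (rule norm_deriv_blaschke)

lemma \<beta>_nonneg: "\<beta> \<ge> 0"
  by (simp add: \<beta>_def)

lemma \<beta>_pos:
  assumes "n \<ge> 1"
  shows "\<beta> > 0"
  unfolding \<beta>_eq
proof (rule sum_pos)
  fix j assume j: "j \<in> {1..n}"
  have "z \<noteq> a j"
    using norm_pole[OF j] norm_z by auto
  then show "0 < ((norm (a j))\<^sup>2 - 1) / (norm (z - a j))\<^sup>2"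
    using norm_pole[OF j] by simp
qed (use assms in auto)

lemma z_notin_poles: "z \<notin> a ` {1..n}"
  using norm_pole norm_z by force

lemma W_z: "W n a z \<noteq> 0"
  using W_nonzero[of n a z] norm_pole norm_z by auto

lemma has_field_derivative_divide_W:
  "((\<lambda>w. poly Q w / W n a w) has_field_derivative
    (poly (pderiv Q) z * W n a z - poly Q z * poly (pderiv (pole_poly n a)) z)
      / (W n a z * W n a z)) (at z)"
  using W_z unfolding poly_pole_poly[symmetric]
  by (intro DERIV_divide poly_DERIV)

lemma Re_log_deriv_W:
  "2 * Re (z * poly (pderiv (pole_poly n a)) z / W n a z) = real n - \<beta>"
proof -
  have "z * poly (pderiv (pole_poly n a)) z / W n a z = (\<Sum>j=1..n. z / (z - a j))"
    using log_pderiv_prod_linear_factors[OF finite_atLeastAtMost z_notin_poles]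
    unfolding poly_pole_poly[symmetric] pole_poly_def[symmetric]
      times_divide_eq_right[symmetric, of z "poly (pderiv (pole_poly n a)) z"]
    by (simp add: sum_distrib_left)
  then have "2 * Re (z * poly (pderiv (pole_poly n a)) z / W n a z)
      = (\<Sum>j=1..n. 2 * Re (z / (z - a j)))"
    by (simp add: sum_distrib_left)
  also have "\<dots> = (\<Sum>j=1..n. 1 - ((norm (a j))\<^sup>2 - 1) / (norm (z - a j))\<^sup>2)"
    using z_notin_poles by (intro sum.cong Re_circle_divide_diff norm_z) auto
  finally show ?thesis
    by (simp add: \<beta>_eq sum_subtractf)
qed

lemma Re_log_deriv_divide_W:
  assumes "poly Q z \<noteq> 0"
  shows "2 * Re (z * deriv (\<lambda>w. poly Q w / W n a w) z / (poly Q z / W n a z))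
    = 2 * Re (z * poly (pderiv Q) z / poly Q z) - real n + \<beta>"
proof -
  have "z * deriv (\<lambda>w. poly Q w / W n a w) z / (poly Q z / W n a z)
      = z * poly (pderiv Q) z / poly Q z - z * poly (pderiv (pole_poly n a)) z / W n a z"
    unfolding DERIV_imp_deriv[OF has_field_derivative_divide_W]
    using assms W_z by (simp add: field_simps)
  then show ?thesis
    using Re_log_deriv_W by simp
qed

text \<open>The numerator contributes at most \<open>degree Q \<le> n\<close>, which the
  \<open>- n\<close> from \<open>W\<close> absorbs, leaving the bound
  \<open>\<beta>\<close>.\<close>

lemma norm_deriv_le_of_zero_free:
  assumes "degree Q \<le> n" "\<And>w. norm w \<le> 1 \<Longrightarrow> poly Q w \<noteq> 0"
  defines "S \<equiv> \<lambda>w. poly Q w / W n a w"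
  shows "norm (deriv S z) \<le> norm (of_real \<beta> * S z - z * deriv S z)"
proof -
  have "2 * Re (z * deriv S z / S z) \<le> \<beta> - 0"
    using Re_log_deriv_divide_W[of Q] Re_log_pderiv_le_degree[of Q z] assms norm_z by force
  then have "(norm (z * deriv S z))\<^sup>2 \<le> (norm (of_real \<beta> * S z - z * deriv S z))\<^sup>2"
    using norm_add_le_norm_diff[of "S z" "z * deriv S z" \<beta> 0] \<beta>_nonneg by simp
  then show ?thesis
    using norm_z by (simp add: norm_mult)
qed

section \<open>Maximum principle and the bound for \<open>R\<close> and its conjugate
  transpose\<close>

context
  fixes P :: "complex poly" and R :: "complex \<Rightarrow> complex"
  assumes R_eq: "R = (\<lambda>w. poly P w / W n a w)"
begin

lemma continuous_on_R: "continuous_on (cball 0 1) R"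
  unfolding R_eq poly_pole_poly[symmetric] using W_nonzero[of n a] norm_pole
  by (intro continuous_intros) (auto simp: poly_pole_poly)

lemma norm_R_le_sup_circle:
  assumes "norm w = 1"
  shows "norm (R w) \<le> sup_unit_circle R"
proof -
  have "continuous_on (sphere 0 1) (\<lambda>w. norm (R w))"
    using continuous_on_subset[OF continuous_on_R] by (intro continuous_on_norm) auto
  then have "bdd_above ((\<lambda>w. norm (R w)) ` sphere 0 1)"
    by (intro bounded_imp_bdd_above compact_imp_bounded compact_continuous_image) auto
  then show ?thesis
    unfolding sup_unit_circle_def using assms by (intro cSUP_upper) auto
qed

lemma norm_R_le_sup:
  assumes "norm w \<le> 1"
  shows "norm (R w) \<le> sup_unit_circle R"
proof (rule maximum_modulus_frontier[of R "cball 0 1"])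
  show "R holomorphic_on interior (cball 0 1)"
    unfolding R_eq poly_pole_poly[symmetric] using W_nonzero[of n a] norm_pole
    by (intro holomorphic_intros) (auto simp: poly_pole_poly)
qed (use continuous_on_R norm_R_le_sup_circle assms in auto)

lemma sup_unit_circle_nonneg: "sup_unit_circle R \<ge> 0"
  using norm_R_le_sup_circle[OF norm_z] norm_ge_zero order_trans by blast

text \<open>By the maximum principle \<open>R - \<mu>\<close> has no zero in the closed disc. It
  keeps the derivative of \<open>R\<close>, and its numerator still has degree at most
  \<open>n\<close>.\<close>

lemma deriv_R_le_shifted:
  assumes "degree P \<le> n" "norm \<mu> > sup_unit_circle R"
  shows "norm (deriv R z) \<le> norm (of_real \<beta> * R z - z * deriv R z - of_real \<beta> * \<mu>)"
proof -
  define Q where "Q = P - smult \<mu> (pole_poly n a)"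
  define S where "S = (\<lambda>w. poly Q w / W n a w)"
  have Q: "poly Q w = (R w - \<mu>) * W n a w" if "W n a w \<noteq> 0" for w
    using that by (simp add: Q_def R_eq poly_pole_poly algebra_simps)
  have "poly Q w \<noteq> 0" if "norm w \<le> 1" for w
    using Q[of w] W_nonzero[of n a w] norm_pole norm_R_le_sup[OF that] assms(2) that by auto
  moreover have "degree Q \<le> n"
    unfolding Q_def using assms(1) degree_pole_poly[of n a]
    by (intro degree_diff_le) (auto intro: order_trans[OF degree_smult_le])
  ultimately have "norm (deriv S z) \<le> norm (of_real \<beta> * S z - z * deriv S z)"
    unfolding S_def by (intro norm_deriv_le_of_zero_free)
  moreover have "S z = R z - \<mu>"
    using Q[OF W_z] W_z by (simp add: S_def)
  moreover have "deriv S z = deriv R z"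
    unfolding S_def R_eq DERIV_imp_deriv[OF has_field_derivative_divide_W]
    by (simp add: Q_def poly_pole_poly pderiv_diff pderiv_smult algebra_simps)
  ultimately show ?thesis
    by (simp add: algebra_simps)
qed

lemma norm_deriv_add_conjugate_le:
  assumes "degree P \<le> n" "n \<ge> 1"
  shows "norm (deriv R z) + norm (of_real \<beta> * R z - z * deriv R z) \<le> \<beta> * sup_unit_circle R"
\<comment> \<open>The distance lemma needs \<open>v > 0\<close>; if the derivative vanishes, the
  claim reduces to \<open>|R z| \<le> M\<close>.\<close>
proof (cases "deriv R z = 0")
  case True
  then show ?thesis
    using norm_R_le_sup_circle[OF norm_z] \<beta>_nonneg by (simp add: norm_mult mult_left_mono)
next
  case False
  \<comment> \<open>Put \<open>\<nu> = \<beta> \<mu>\<close>: since \<open>\<beta> > 0\<close>, all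
    \<open>\<mu>\<close> with \<open>|\<mu>| > M\<close> give exactly the exterior of the disc of
    radius \<open>\<beta> M\<close>.\<close>
  have "norm (deriv R z) \<le> norm (of_real \<beta> * R z - z * deriv R z - \<nu>)"
    if "norm \<nu> > \<beta> * sup_unit_circle R" for \<nu>
    using deriv_R_le_shifted[of "\<nu> / of_real \<beta>"] assms \<beta>_pos that
    by (simp add: norm_divide field_simps)
  then have "norm (of_real \<beta> * R z - z * deriv R z) + norm (deriv R z) \<le> \<beta> * sup_unit_circle R"
    using False \<beta>_nonneg sup_unit_circle_nonneg
    by (intro norm_add_le_of_outer_distance) auto
  then show ?thesis
    by (simp only: add.commute)
qed

end

end

theorem theorem1:
  fixes n m :: nat and a b :: "nat \<Rightarrow> complex" and k :: real
    and \<alpha> z :: complex and P :: "complex poly" and R :: "complex \<Rightarrow> complex"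
  assumes "n \<ge> 1"
    and "\<And>j. j \<in> {1..n} \<Longrightarrow> norm (a j) > 1"
    and "k \<ge> 1"
    and "R \<in> rational_space n a"
    and "R = (\<lambda>w. poly P w / W n a w)"
    and "P = smult \<alpha> (\<Prod>j=1..m. [:- b j, 1:])"
    and "\<alpha> \<noteq> 0"
    and "m \<le> n"
    and "\<And>j. j \<in> {1..m} \<Longrightarrow> norm (b j) \<ge> k"
    and "norm z = 1"
  shows "norm (deriv R z) \<le>
    1 / 2 * (norm (deriv (blaschke n a) z)
      - real n * (k - 1) * (norm (R z))\<^sup>2 / ((k + 1) * (sup_unit_circle R)\<^sup>2)
      - 2 * (norm (R z))\<^sup>2 / (sup_unit_circle R)\<^sup>2
          * (real n / (k + 1) - (\<Sum>j=1..m. 1 / (1 + norm (b j)))))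
    * sup_unit_circle R"
proof -
  interpret outer_poles n a z
    using assms by unfold_locales auto
  define M where "M = sup_unit_circle R"
  define c where "c = real n - 2 * (\<Sum>j=1..m. 1 / (1 + norm (b j)))"
  define v where "v = norm (deriv R z)"
  define u where "u = of_real \<beta> * R z - z * deriv R z"
  have "degree P = m"
    unfolding assms(6) using assms(7) by (simp add: degree_prod_eq_sum_degree)
  then have vu: "v + norm u \<le> \<beta> * M"
    using norm_deriv_add_conjugate_le[OF assms(5)] assms(1,8)
    by (simp add: v_def u_def M_def)
  have M: "M \<ge> 0"
    unfolding M_def by (rule sup_unit_circle_nonneg[OF assms(5)])
  \<comment> \<open>Twice the sum over the zeros bounds the numerator's share; together with
    \<open>\<beta> - n\<close> from the poles this gives \<open>\<beta> - c\<close>.\<close>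
  have "2 * Re (z * deriv R z / R z) \<le> \<beta> - c" if "R z \<noteq> 0"
  proof -
    have Pz: "poly P z \<noteq> 0"
      using that by (auto simp: assms(5))
    then have zb: "z \<notin> b ` {1..m}"
      unfolding assms(6) by (auto simp: prod_linear_factors_eq_0_iff poly_prod)
    have "poly (pderiv P) z / poly P z = (\<Sum>j=1..m. 1 / (z - b j))"
      using log_pderiv_prod_linear_factors[OF finite_atLeastAtMost zb] assms(7)
      unfolding assms(6) pderiv_smult poly_smult by simp
    then have "z * poly (pderiv P) z / poly P z = (\<Sum>j=1..m. z / (z - b j))"
      unfolding times_divide_eq_right[symmetric, of z "poly (pderiv P) z"]
      by (simp add: sum_distrib_left)
    also have "Re \<dots> \<le> (\<Sum>j=1..m. 1 / (1 + norm (b j)))"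
      unfolding Re_sum using zb assms(3,9)
      by (intro sum_mono Re_circle_divide_diff_le norm_z) force+
    finally show ?thesis
      using Re_log_deriv_divide_W[OF Pz] by (simp add: c_def assms(5))
  qed
  then have "v\<^sup>2 + \<beta> * c * (norm (R z))\<^sup>2 \<le> (norm u)\<^sup>2"
    using norm_add_le_norm_diff[of "R z" "z * deriv R z" \<beta> c] \<beta>_nonneg norm_z
    by (simp add: u_def v_def norm_mult)
  also have "\<dots> \<le> (\<beta> * M - v)\<^sup>2"
    using vu by (intro power_mono) auto
  \<comment> \<open>The terms \<open>v^2\<close> cancel, and every remaining term carries a factor
    \<open>\<beta>\<close>, which is positive.\<close>
  finally have "\<beta> * (c * (norm (R z))\<^sup>2 + 2 * v * M) \<le> \<beta> * (\<beta> * M\<^sup>2)"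
    by (simp add: power2_eq_square algebra_simps)
  then have key: "c * (norm (R z))\<^sup>2 + 2 * v * M \<le> \<beta> * M\<^sup>2"
    using \<beta>_pos[OF assms(1)] by simp
  \<comment> \<open>The coefficients \<open>n (k - 1) / (k + 1)\<close> and
    \<open>2 n / (k + 1)\<close> add up to \<open>n\<close>, so the two subtracted terms combine to
    \<open>c |R z|^2 / M^2\<close>. For \<open>s = 0\<close> both sides are 0.\<close>
  have merge: "real n * (k - 1) * r / ((k + 1) * s) + 2 * r / s * (real n / (k + 1) - t)
      = (real n - 2 * t) * r / s" for r s t
  proof (cases "s = 0")
    case False
    then show ?thesis
      using assms(3) by (simp add: divide_simps) (simp add: algebra_simps)
  qed simp
  have "v \<le> 1 / 2 * (\<beta> - c * (norm (R z))\<^sup>2 / M\<^sup>2) * M"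
  proof (cases "M = 0")
    case True \<comment> \<open>impossible since \<open>P \<noteq> 0\<close>, but harmless because both sides are then 0\<close>
    then have "v + norm u \<le> 0"
      using vu by simp
    then have "v \<le> 0"
      using norm_ge_zero[of u] by linarith
    then show ?thesis
      using True by simp
  next
    case False
    \<comment> \<open>One extra factor \<open>M\<close> clears the denominator, so that
      \<open>key\<close> applies; it is cancelled afterwards as \<open>M > 0\<close>.\<close>
    then have "(\<beta> - c * (norm (R z))\<^sup>2 / M\<^sup>2) * M * M = \<beta> * M\<^sup>2 - c * (norm (R z))\<^sup>2"
      by (simp add: field_simps power2_eq_square)
    then have "2 * v * M \<le> (\<beta> - c * (norm (R z))\<^sup>2 / M\<^sup>2) * M * M"
      using key by linarith
    then have "2 * v \<le> (\<beta> - c * (norm (R z))\<^sup>2 / M\<^sup>2) * M"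
      using False M mult_le_cancel_right_pos[of M] by simp
    then show ?thesis
      by simp
  qed
  then show ?thesis
    using merge[of "(norm (R z))\<^sup>2" "M\<^sup>2" "\<Sum>j=1..m. 1 / (1 + norm (b j))"]
    by (simp only: v_def \<beta>_def M_def c_def diff_diff_add)
qed

end
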